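(* Let $A$ and $B$ be two isoclinic skew left braces of finite order. Then $\mathrm{Pb}(A)=\mathrm{Pb}(B)$ and $|\Gamma_2(A)\cap\mathrm{Ann}(A)|=|\Gamma_2(B)\cap\mathrm{Ann}(B)|$.
   Context: A skew left brace is a set $B$ with two group structures $(B,+)$ and $(B,\circ)$ (neither assumed abelian) such that $a\circ(b+c)=(a\circ b)-a+(a\circ c)$ for all $a,b,c\in B$, where $-a$ is the inverse of $a$ in $(B,+)$. The identities of the two groups coincide and are denoted by $1$. Put $a*b:=-a+(a\circ b)-b$ and $[a,b]^+:=a+b-a-b$. For a finite skew left brace $B$, the commuting probability is $$\mathrm{Pb}(B):=\frac{1}{|B|^2}\,\bigl|\{(a,b)\in B\times B \mid a*b=b*a=[a,b]^+=1\}\bigr|.$$ The annihilator of $B$ is $\mathrm{Ann}(B):=\{a\in B\mid a+b=b+a=a\circ b=b\circ a \text{ for all } b\in B\}$, an ideal of $B$. Let $\Gamma_2(B)$ be the subgroup of $(B,+)$ generated by all elements $a*b$ and $[a,b]^+$ with $a,b\in B$; it is an ideal of $B$. The maps $\phi^B_+,\phi^B_*:(B/\mathrm{Ann}(B))^2\to\Gamma_2(B)$ given by $\phi^B_+(\bar a,\bar b)=[a,b]^+$ and $\phi^B_*(\bar a,\bar b)=a*b$ are well defined. A brace isomorphism is a bijection that is a homomorphism for both $+$ and $\circ$. Two skew left braces $A$ and $B$ are isoclinic if there exist brace isomorphisms $\xi:A/\mathrm{Ann}(A)\to B/\mathrm{Ann}(B)$ and $\theta:\Gamma_2(A)\to\Gamma_2(B)$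 such that $\theta\circ\phi^A_+=\phi^B_+\circ(\xi\times\xi)$ and $\theta\circ\phi^A_*=\phi^B_*\circ(\xi\times\xi)$ (here $\circ$ is composition of maps). *)

theory Defs
  imports Complex_Main "HOL-Algebra.QuotRing" "HOL-Algebra.Generated_Groups"
begin

text \<open>
  A skew left brace is encoded on the two-operation record of \<^theory>\<open>HOL-Algebra.Ring\<close>:
  \<open>\<oplus>\<close> is the additive group operation (not assumed commutative) and \<open>\<otimes>\<close> is the circle
  operation. No ring axiom is assumed. The record has one slot for each of the two identities;
  that they coincide is a consequence of the axioms (\<open>one_eq_zero\<close>).
\<close>

locale skew_left_brace =
  fixes B (structure)
  assumes add_group: "group (add_monoid B)"
    and circ_group: "group B"
    and compat: "\<lbrakk> a \<in> carrier B; b \<in> carrier B; c \<in> carrier B \<rbrakk>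
      \<Longrightarrow> a \<otimes> (b \<oplus> c) = (a \<otimes> b) \<ominus> a \<oplus> (a \<otimes> c)"

definition brace_star :: "('a, 'm) ring_scheme \<Rightarrow> 'a \<Rightarrow> 'a \<Rightarrow> 'a" where
  "brace_star B a b = (\<ominus>\<^bsub>B\<^esub> a) \<oplus>\<^bsub>B\<^esub> (a \<otimes>\<^bsub>B\<^esub> b) \<ominus>\<^bsub>B\<^esub> b"

definition add_commutator :: "('a, 'm) ring_scheme \<Rightarrow> 'a \<Rightarrow> 'a \<Rightarrow> 'a" where
  "add_commutator B a b = a \<oplus>\<^bsub>B\<^esub> b \<ominus>\<^bsub>B\<^esub> a \<ominus>\<^bsub>B\<^esub> b"

definition Pb :: "('a, 'm) ring_scheme \<Rightarrow> real" where
  "Pb B = real (card {(a, b) \<in> carrier B \<times> carrier B.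
        brace_star B a b = \<one>\<^bsub>B\<^esub> \<and> brace_star B b a = \<one>\<^bsub>B\<^esub> \<and> add_commutator B a b = \<one>\<^bsub>B\<^esub>})
      / (real (card (carrier B)))\<^sup>2"

definition Ann :: "('a, 'm) ring_scheme \<Rightarrow> 'a set" where
  "Ann B = {a \<in> carrier B. \<forall>b \<in> carrier B.
      a \<oplus>\<^bsub>B\<^esub> b = b \<oplus>\<^bsub>B\<^esub> a \<and> b \<oplus>\<^bsub>B\<^esub> a = a \<otimes>\<^bsub>B\<^esub> b \<and> a \<otimes>\<^bsub>B\<^esub> b = b \<otimes>\<^bsub>B\<^esub> a}"

definition Gamma2 :: "('a, 'm) ring_scheme \<Rightarrow> 'a set" where
  "Gamma2 B = generate (add_monoid B)
     ({brace_star B a b | a b. a \<in> carrier B \<and> b \<in> carrier B} \<union>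
      {add_commutator B a b | a b. a \<in> carrier B \<and> b \<in> carrier B})"

text \<open>
  The quotient brace is \<open>B Quot Ann B\<close>: its carrier consists of the additive cosets of \<open>Ann B\<close>
  and, although it is named after rings, its operations are the ones induced by \<open>\<oplus>\<close> and \<open>\<otimes>\<close>
  (\<open>Quot_add\<close> and \<open>Quot_circ\<close>).

  The maps \<open>phi_plus\<close> and \<open>phi_star\<close> on pairs of cosets take the common value on all
  representatives; \<open>phi_plus_coset\<close> and \<open>phi_star_coset\<close> show that this is well defined.
\<close>

definition phi_plus :: "('a, 'm) ring_scheme \<Rightarrow> 'a set \<Rightarrow> 'a set \<Rightarrow> 'a" where
  "phi_plus B X Y = the_elem {add_commutator B a b | a b. a \<in> X \<and> b \<in> Y}"

definition phi_star :: "('a, 'm) ring_scheme \<Rightarrow> 'a set \<Rightarrow> 'a set \<Rightarrow> 'a" where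
  "phi_star B X Y = the_elem {brace_star B a b | a b. a \<in> X \<and> b \<in> Y}"

definition brace_iso :: "('a, 'm) ring_scheme \<Rightarrow> ('b, 'n) ring_scheme \<Rightarrow> ('a \<Rightarrow> 'b) set" where
  "brace_iso A B = iso (add_monoid A) (add_monoid B) \<inter> iso A B"

definition isoclinic :: "('a, 'm) ring_scheme \<Rightarrow> ('b, 'n) ring_scheme \<Rightarrow> bool" where
  "isoclinic A B \<longleftrightarrow>
    (\<exists>\<xi> \<in> brace_iso (A Quot Ann A) (B Quot Ann B).
     \<exists>\<theta> \<in> brace_iso (A\<lparr>carrier := Gamma2 A\<rparr>) (B\<lparr>carrier := Gamma2 B\<rparr>).
       \<forall>X \<in> carrier (A Quot Ann A). \<forall>Y \<in> carrier (A Quot Ann A).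
         \<theta> (phi_plus A X Y) = phi_plus B (\<xi> X) (\<xi> Y) \<and>
         \<theta> (phi_star A X Y) = phi_star B (\<xi> X) (\<xi> Y))"

sublocale skew_left_brace \<subseteq> circ: group B
  by (rule circ_group)

sublocale skew_left_brace \<subseteq> plus: group "add_monoid B"
  rewrites "carrier (add_monoid B) = carrier B"
    and "mult (add_monoid B) = add B"
    and "one (add_monoid B) = zero B"
    and "m_inv (add_monoid B) = a_inv B"
  by (rule add_group) (simp_all add: a_inv_def fun_eq_iff)

context skew_left_brace
begin

lemma one_eq_zero: "\<one> = \<zero>"
proof -
  have "\<one> \<otimes> (\<zero> \<oplus> \<zero>) = (\<one> \<otimes> \<zero>) \<ominus> \<one> \<oplus> (\<one> \<otimes> \<zero>)"
    by (rule compat) simp_all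
  then have "\<zero> = \<ominus> \<one>"
    by (simp add: a_minus_def)
  then show ?thesis
    by (metis circ.one_closed plus.inv_inv plus.inv_one)
qed

lemma AnnD:
  assumes "z \<in> Ann B"
  shows "z \<in> carrier B"
    and "\<And>b. b \<in> carrier B \<Longrightarrow> b \<oplus> z = z \<oplus> b"
    and "\<And>b. b \<in> carrier B \<Longrightarrow> z \<otimes> b = z \<oplus> b"
    and "\<And>b. b \<in> carrier B \<Longrightarrow> b \<otimes> z = z \<oplus> b"
  using assms unfolding Ann_def by auto

lemma Ann_plus_circ_plus:
  assumes z: "z \<in> Ann B" and w: "w \<in> Ann B" and a: "a \<in> carrier B" and b: "b \<in> carrier B"
  shows "(z \<oplus> a) \<otimes> (w \<oplus> b) = (z \<oplus> w) \<oplus> (a \<otimes> b)"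
proof -
  note zc = AnnD(1)[OF z] and wc = AnnD(1)[OF w]
  have "(z \<oplus> a) \<otimes> (w \<oplus> b) = (z \<otimes> a) \<otimes> (b \<otimes> w)"
    using AnnD(3)[OF z a] AnnD(4)[OF w b] by simp
  also have "\<dots> = z \<otimes> ((a \<otimes> b) \<otimes> w)"
    using zc wc a b by (simp add: circ.m_assoc)
  also have "\<dots> = z \<oplus> (w \<oplus> (a \<otimes> b))"
    using AnnD(3)[OF z] AnnD(4)[OF w] wc a b by simp
  finally show ?thesis
    using zc wc a b by (simp add: plus.m_assoc)
qed

lemma Ann_subgroup: "subgroup (Ann B) (add_monoid B)"
proof -
  have zero: "\<zero> \<in> Ann B"
  proof -
    have "\<zero> \<otimes> b = b" "b \<otimes> \<zero> = b" if "b \<in> carrier B" for b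
      using that circ.l_one circ.r_one unfolding one_eq_zero by blast+
    then show ?thesis
      unfolding Ann_def mem_Collect_eq by (metis plus.l_one plus.r_one plus.one_closed)
  qed
  have add: "z \<oplus> w \<in> Ann B" if z: "z \<in> Ann B" and w: "w \<in> Ann B" for z w
  proof -
    note zc = AnnD(1)[OF z] and wc = AnnD(1)[OF w]
    have "(z \<oplus> w) \<oplus> b = b \<oplus> (z \<oplus> w)" if "b \<in> carrier B" for b
      using that zc wc AnnD(2)[OF z] AnnD(2)[OF w] by (metis plus.m_assoc)
    moreover have "z \<oplus> w = z \<otimes> w"
      using AnnD(3)[OF z wc] by simp
    then have "(z \<oplus> w) \<otimes> b = (z \<oplus> w) \<oplus> b" "b \<otimes> (z \<oplus> w) = (z \<oplus> w) \<oplus> b" if "b \<in> carrier B" for b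
    proof -
      have "(z \<otimes> w) \<otimes> b = z \<oplus> (w \<oplus> b)"
        using that zc wc AnnD(3)[OF z] AnnD(3)[OF w] by (metis circ.m_assoc plus.m_closed)
      then show "(z \<oplus> w) \<otimes> b = (z \<oplus> w) \<oplus> b"
        using that zc wc \<open>z \<oplus> w = z \<otimes> w\<close> by (metis plus.m_assoc)
      have "b \<otimes> (z \<otimes> w) = (b \<otimes> z) \<otimes> w"
        using that zc wc by (simp only: circ.m_assoc)
      also have "\<dots> = w \<oplus> (z \<oplus> b)"
        using that zc wc AnnD(4)[OF z] AnnD(4)[OF w] by simp
      also have "\<dots> = (z \<oplus> w) \<oplus> b"
        using that zc wc AnnD(2)[OF w zc] by (metis plus.m_assoc)
      finally show "b \<otimes> (z \<oplus> w) = (z \<oplus> w) \<oplus> b"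
        using \<open>z \<oplus> w = z \<otimes> w\<close> by simp
    qed
    ultimately show ?thesis
      unfolding Ann_def using zc wc by simp
  qed
  have inv: "\<ominus> z \<in> Ann B" if z: "z \<in> Ann B" for z
  proof -
    note zc = AnnD(1)[OF z]
    have c: "\<ominus> z \<oplus> b = b \<oplus> \<ominus> z" if b: "b \<in> carrier B" for b
    proof -
      have "z \<oplus> (b \<oplus> \<ominus> z) = b"
        using b zc AnnD(2)[OF z b] by (metis plus.inv_closed plus.m_assoc plus.r_inv plus.r_one)
      then show ?thesis
        using b zc by (metis plus.inv_solve_left plus.inv_closed plus.m_closed)
    qed
    have m: "z \<otimes> (\<ominus> z) = \<one>"
      using AnnD(3)[OF z] zc by (simp add: one_eq_zero)
    have l: "(\<ominus> z) \<otimes> b = \<ominus> z \<oplus> b" if b: "b \<in> carrier B" for b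
    proof -
      have "z \<otimes> (\<ominus> z \<oplus> b) = b"
        using AnnD(3)[OF z] zc b by (simp add: plus.m_assoc[symmetric])
      moreover have "z \<otimes> ((\<ominus> z) \<otimes> b) = b"
        using m zc b by (simp add: circ.m_assoc[symmetric])
      ultimately show ?thesis
        using zc b by (metis circ.inv_solve_left plus.inv_closed plus.m_closed circ.m_closed)
    qed
    have r: "b \<otimes> (\<ominus> z) = \<ominus> z \<oplus> b" if b: "b \<in> carrier B" for b
    proof -
      have "(\<ominus> z \<oplus> b) \<otimes> z = b"
        using AnnD(4)[OF z] zc b by (simp add: plus.m_assoc[symmetric])
      moreover have "(b \<otimes> (\<ominus> z)) \<otimes> z = b"
        using AnnD(4)[OF z, of "\<ominus> z"] zc b circ.r_one[unfolded one_eq_zero] by (simp add: circ.m_assoc)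
      ultimately show ?thesis
        using zc b by (metis circ.right_cancel plus.inv_closed plus.m_closed circ.m_closed)
    qed
    show ?thesis
      unfolding Ann_def using zc c l r by simp
  qed
  show ?thesis
    by (rule plus.subgroupI) (use AnnD(1) zero add inv in \<open>auto simp flip: a_inv_def\<close>)
qed

lemma Ann_normal: "Ann B \<lhd> add_monoid B"
proof -
  have "x \<oplus> h \<oplus> \<ominus> x \<in> Ann B" if "x \<in> carrier B" "h \<in> Ann B" for x h
  proof -
    have "x \<oplus> h \<oplus> \<ominus> x = h"
      using that AnnD(1,2)[of h] by (simp add: plus.m_assoc)
    then show ?thesis
      using that by simp
  qed
  then show ?thesis
    unfolding plus.normal_inv_iff using Ann_subgroup by (simp flip: a_inv_def)
qed

lemma Quot_carrier: "carrier (B Quot Ann B) = {Ann B +> a | a. a \<in> carrier B}"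
  by (auto simp: FactRing_def A_RCOSETS_def RCOSETS_def a_r_coset_def)

lemma coset_eq: "Ann B +> a = {z \<oplus> a | z. z \<in> Ann B}"
  by (auto simp: a_r_coset_def r_coset_def)

lemma coset_absorb:
  assumes z: "z \<in> Ann B" and a: "a \<in> carrier B"
  shows "Ann B +> (z \<oplus> a) = Ann B +> a"
proof -
  have "z \<oplus> a \<in> Ann B +> a"
    using z by (auto simp: coset_eq)
  then show ?thesis
    using plus.repr_independence[of "z \<oplus> a" "Ann B" a] a Ann_subgroup by (simp add: a_r_coset_def)
qed

lemma Quot_add:
  assumes "a \<in> carrier B" "b \<in> carrier B"
  shows "(Ann B +> a) \<oplus>\<^bsub>B Quot Ann B\<^esub> (Ann B +> b) = Ann B +> (a \<oplus> b)"
  using normal.rcos_sum[OF Ann_normal] assms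
  by (simp add: FactRing_def set_add_def a_r_coset_def)

lemma Quot_circ:
  assumes a: "a \<in> carrier B" and b: "b \<in> carrier B"
  shows "(Ann B +> a) \<otimes>\<^bsub>B Quot Ann B\<^esub> (Ann B +> b) = Ann B +> (a \<otimes> b)"
proof -
  have *: "Ann B +> x \<otimes> y = Ann B +> a \<otimes> b" if "x \<in> Ann B +> a" "y \<in> Ann B +> b" for x y
  proof -
    from that obtain z w where zw: "z \<in> Ann B" "w \<in> Ann B" and "x = z \<oplus> a" "y = w \<oplus> b"
      by (auto simp: coset_eq)
    moreover have "z \<oplus> w \<in> Ann B"
      using subgroup.m_closed[OF Ann_subgroup zw] by simp
    ultimately show ?thesis
      using a b by (simp add: Ann_plus_circ_plus coset_absorb)
  qed
  have "a \<in> Ann B +> a" if "a \<in> carrier B" for a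
    using plus.rcos_self[OF _ Ann_subgroup] that by (simp add: a_r_coset_def)
  then have "Ann B +> a \<noteq> {}" "Ann B +> b \<noteq> {}"
    using a b by blast+
  then show ?thesis
    by (auto simp: FactRing_def rcoset_mult_def *)
qed

lemma Ann_cancel:
  assumes z: "z \<in> Ann B" and w: "w \<in> Ann B"
    and x: "x \<in> carrier B" and y: "y \<in> carrier B" and u: "u \<in> carrier B"
  shows "\<ominus> (z \<oplus> x) \<oplus> ((z \<oplus> w) \<oplus> u) \<ominus> (w \<oplus> y) = \<ominus> x \<oplus> u \<ominus> y"
proof -
  note zc = AnnD(1)[OF z] and wc = AnnD(1)[OF w]
  have "w \<oplus> (u \<oplus> (\<ominus> y \<oplus> \<ominus> w)) = (w \<oplus> (u \<oplus> \<ominus> y)) \<oplus> \<ominus> w"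
    using wc u y by (simp add: plus.m_assoc)
  also have "\<dots> = ((u \<oplus> \<ominus> y) \<oplus> w) \<oplus> \<ominus> w"
    using AnnD(2)[OF w, of "u \<oplus> \<ominus> y"] u y by simp
  also have "\<dots> = u \<oplus> \<ominus> y"
    using wc u y by (simp add: plus.m_assoc)
  finally have "w \<oplus> (u \<oplus> (\<ominus> y \<oplus> \<ominus> w)) = u \<oplus> \<ominus> y" .
  moreover have "\<ominus> z \<oplus> (z \<oplus> v) = v" if "v \<in> carrier B" for v
    using zc that by (simp add: plus.m_assoc[symmetric])
  ultimately show ?thesis
    using zc wc x y u by (simp add: a_minus_def plus.inv_mult_group plus.m_assoc)
qed

lemma phi_star_coset:
  assumes a: "a \<in> carrier B" and b: "b \<in> carrier B"
  shows "phi_star B (Ann B +> a) (Ann B +> b) = brace_star B a b"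
proof -
  have "brace_star B (z \<oplus> a) (w \<oplus> b) = brace_star B a b" if "z \<in> Ann B" "w \<in> Ann B" for z w
    using that a b by (simp add: brace_star_def Ann_plus_circ_plus Ann_cancel)
  moreover have "\<zero> \<in> Ann B"
    using subgroup.one_closed[OF Ann_subgroup] by simp
  ultimately have "{brace_star B x y | x y. x \<in> Ann B +> a \<and> y \<in> Ann B +> b} = {brace_star B a b}"
    by (auto simp: coset_eq) metis
  then show ?thesis
    by (simp add: phi_star_def)
qed

lemma phi_plus_coset:
  assumes a: "a \<in> carrier B" and b: "b \<in> carrier B"
  shows "phi_plus B (Ann B +> a) (Ann B +> b) = add_commutator B a b"
proof -
  have "add_commutator B (z \<oplus> a) (w \<oplus> b) = add_commutator B a b"
    if z: "z \<in> Ann B" and w: "w \<in> Ann B" for z w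
  proof -
    note zc = AnnD(1)[OF z] and wc = AnnD(1)[OF w]
    have "(z \<oplus> a) \<oplus> (w \<oplus> b) = z \<oplus> ((a \<oplus> w) \<oplus> b)"
      using zc wc a b by (simp add: plus.m_assoc)
    also have "\<dots> = z \<oplus> (w \<oplus> (a \<oplus> b))"
      using zc wc a b AnnD(2)[OF w a] by (simp add: plus.m_assoc)
    also have "\<dots> = (w \<oplus> (a \<oplus> b)) \<oplus> z"
      using AnnD(2)[OF z] wc a b by simp
    finally have 1: "(z \<oplus> a) \<oplus> (w \<oplus> b) = (w \<oplus> (a \<oplus> b)) \<oplus> z" .
    have 2: "\<ominus> (z \<oplus> a) = \<ominus> z \<oplus> \<ominus> a"
      using zc a AnnD(2)[OF z a] by (metis plus.inv_mult_group)
    have "(w \<oplus> (a \<oplus> b)) \<oplus> z \<oplus> (\<ominus> z \<oplus> \<ominus> a) = w \<oplus> (a \<oplus> b \<oplus> \<ominus> a)"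
    proof -
      have "z \<oplus> (\<ominus> z \<oplus> \<ominus> a) = \<ominus> a"
        using zc a by (simp add: plus.m_assoc[symmetric])
      then show ?thesis
        using zc wc a b by (simp add: plus.m_assoc)
    qed
    also have "\<dots> = (a \<oplus> b \<oplus> \<ominus> a) \<oplus> w"
      using AnnD(2)[OF w] a b by simp
    finally have 3: "(w \<oplus> (a \<oplus> b)) \<oplus> z \<oplus> (\<ominus> z \<oplus> \<ominus> a) = (a \<oplus> b \<oplus> \<ominus> a) \<oplus> w" .
    have 4: "\<ominus> (w \<oplus> b) = \<ominus> w \<oplus> \<ominus> b"
      using wc b AnnD(2)[OF w b] by (metis plus.inv_mult_group)
    have 5: "w \<oplus> (\<ominus> w \<oplus> \<ominus> b) = \<ominus> b"
      using wc b by (simp add: plus.m_assoc[symmetric])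
    show ?thesis
      unfolding add_commutator_def a_minus_def 1 2 3 4
      using 5 wc a b by (simp add: plus.m_assoc)
  qed
  moreover have "\<zero> \<in> Ann B"
    using subgroup.one_closed[OF Ann_subgroup] by simp
  ultimately have "{add_commutator B x y | x y. x \<in> Ann B +> a \<and> y \<in> Ann B +> b} = {add_commutator B a b}"
    by (auto simp: coset_eq) metis
  then show ?thesis
    by (simp add: phi_plus_def)
qed

end

end

theory Submission
  imports Defs
begin

text \<open>
  Both quantities can be read off from the data that an isoclinism preserves.

  The values \<open>a * b\<close> and \<open>[a, b]\<^sup>+\<close> depend only on the cosets of \<open>a\<close> and \<open>b\<close> modulo \<open>Ann B\<close>. The set
  of commuting pairs is therefore a disjoint union of products \<open>X \<times> Y\<close> of cosets, each of size
  \<open>|Ann B|\<^sup>2\<close>, and by Lagrange's theorem \<open>Pb B\<close> is the proportion of commuting pairs in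
  \<open>B / Ann B\<close> (\<open>Pb_eq_commuting_cosets\<close>). Commutation of two cosets means that \<open>\<phi>\<^sub>+\<close> and \<open>\<phi>\<^sub>*\<close>
  take the value \<open>1\<close>. An isoclinism \<open>(\<xi>, \<theta>)\<close> intertwines these maps and \<open>\<theta>\<close> is injective with
  \<open>\<theta> 1 = 1\<close>, so \<open>\<xi> \<times> \<xi>\<close> is a bijection between the commuting pairs of cosets.

  For the second quantity the point is that \<open>\<theta>\<close> lifts the restriction of \<open>\<xi>\<close> to the image of
  \<open>\<Gamma>\<^sub>2\<close>: \<open>\<xi> (g + Ann A) = \<theta> g + Ann B\<close> for all \<open>g \<in> \<Gamma>\<^sub>2(A)\<close> (\<open>xi_coset_Gamma2\<close>). Both sides are
  additive homomorphisms in \<open>g\<close>, and they agree on the generators because \<open>\<xi>\<close>, being a brace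
  homomorphism, maps the class of \<open>a * b\<close> to the class of \<open>x * y\<close> when it maps the classes of
  \<open>a, b\<close> to those of \<open>x, y\<close>; compatibility of \<open>\<theta>\<close> says that \<open>\<theta>\<close> sends \<open>a * b\<close> to \<open>x * y\<close> itself.
  Since \<open>\<xi>\<close> is injective, \<open>g \<in> Ann A\<close> holds exactly when \<open>\<theta> g \<in> Ann B\<close>, so \<open>\<theta>\<close> restricts to a
  bijection between the two intersections.
\<close>

section \<open>Homomorphisms on a generated subgroup\<close>

text \<open>
  The homomorphisms are required only on the generated subgroup, since \<open>\<theta>\<close> below is defined
  on \<open>\<Gamma>\<^sub>2\<close> and need not extend to the whole brace.
\<close>

lemma hom_eq_on_generate:
  assumes "group G" "group K" and S: "S \<subseteq> carrier G"
    and f: "f \<in> hom (G\<lparr>carrier := generate G S\<rparr>) K"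
    and g: "g \<in> hom (G\<lparr>carrier := generate G S\<rparr>) K"
    and eq: "\<And>s. s \<in> S \<Longrightarrow> f s = g s"
    and x: "x \<in> generate G S"
  shows "f x = g x"
proof -
  let ?H = "G\<lparr>carrier := generate G S\<rparr>"
  have sub: "subgroup (generate G S) G"
    by (rule group.generate_is_subgroup[OF assms(1) S])
  have H: "group ?H"
    by (rule group.subgroup_imp_group[OF assms(1) sub])
  have F: "group_hom ?H K f" and F': "group_hom ?H K g"
    using H assms(2) f g by (auto simp: group_hom_def group_hom_axioms_def)
  have H_inv: "inv\<^bsub>?H\<^esub> h = inv\<^bsub>G\<^esub> h" if "h \<in> generate G S" for h
    by (rule group.m_inv_consistent[OF assms(1) sub that])
  show ?thesis
    using x
  proof (induction rule: generate.induct)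
    case one
    show ?case
      using group_hom.hom_one[OF F] group_hom.hom_one[OF F'] by simp
  next
    case (incl h)
    then show ?case by (rule eq)
  next
    case (inv h)
    then have "h \<in> generate G S" by (rule generate.incl)
    then show ?case
      using group_hom.hom_inv[OF F, of h] group_hom.hom_inv[OF F', of h] H_inv eq[OF inv]
      by simp
  next
    case (eng h1 h2)
    then show ?case
      using hom_mult[OF f, of h1 h2] hom_mult[OF g, of h1 h2] by simp
  qed
qed

section \<open>The quotient by the annihilator\<close>

context skew_left_brace
begin

lemma add_monoid_Quot_Ann: "add_monoid (B Quot Ann B) = add_monoid B Mod Ann B"
  by (simp add: FactRing_def FactGroup_def A_RCOSETS_def set_add_def fun_eq_iff)

lemma group_add_monoid_Quot_Ann: "group (add_monoid (B Quot Ann B))"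
  unfolding add_monoid_Quot_Ann by (rule normal.factorgroup_is_group[OF Ann_normal])

lemma coset_in_Quot [simp]: "a \<in> carrier B \<Longrightarrow> Ann B +> a \<in> carrier (B Quot Ann B)"
  by (auto simp: Quot_carrier)

lemma coset_add_hom: "group_hom (add_monoid B) (add_monoid (B Quot Ann B)) (\<lambda>a. Ann B +> a)"
  using add_group group_add_monoid_Quot_Ann
  by (auto simp: group_hom_def group_hom_axioms_def hom_def Quot_add)

lemma Quot_minus: "a \<in> carrier B \<Longrightarrow> \<ominus>\<^bsub>B Quot Ann B\<^esub> (Ann B +> a) = Ann B +> (\<ominus> a)"
  using group_hom.hom_inv[OF coset_add_hom, of a] by (simp add: a_inv_def)

lemma Quot_star:
  assumes "a \<in> carrier B" "b \<in> carrier B"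
  shows "brace_star (B Quot Ann B) (Ann B +> a) (Ann B +> b) = Ann B +> brace_star B a b"
  using assms by (simp add: brace_star_def a_minus_def Quot_add Quot_circ Quot_minus)

lemma Quot_commutator:
  assumes "a \<in> carrier B" "b \<in> carrier B"
  shows "add_commutator (B Quot Ann B) (Ann B +> a) (Ann B +> b) = Ann B +> add_commutator B a b"
  using assms by (simp add: add_commutator_def a_minus_def Quot_add Quot_minus)

lemma Quot_circ_closed:
  "X \<in> carrier (B Quot Ann B) \<Longrightarrow> Y \<in> carrier (B Quot Ann B) \<Longrightarrow>
    X \<otimes>\<^bsub>B Quot Ann B\<^esub> Y \<in> carrier (B Quot Ann B)"
  by (auto simp: Quot_carrier Quot_circ)

lemma coset_eq_zero_iff:
  assumes "a \<in> carrier B"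
  shows "Ann B +> a = \<zero>\<^bsub>B Quot Ann B\<^esub> \<longleftrightarrow> a \<in> Ann B"
  using assms plus.coset_join1[of "Ann B" a] plus.coset_join2[of a "Ann B"] Ann_subgroup
    subgroup.subset[OF Ann_subgroup]
  by (auto simp: FactRing_def a_r_coset_def)

lemma brace_star_closed: "a \<in> carrier B \<Longrightarrow> b \<in> carrier B \<Longrightarrow> brace_star B a b \<in> carrier B"
  by (simp add: brace_star_def a_minus_def)

lemma add_commutator_closed: "a \<in> carrier B \<Longrightarrow> b \<in> carrier B \<Longrightarrow> add_commutator B a b \<in> carrier B"
  by (simp add: add_commutator_def a_minus_def)

lemma Gamma2_subgroup: "subgroup (Gamma2 B) (add_monoid B)"
  unfolding Gamma2_def
  by (rule group.generate_is_subgroup[OF add_group])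
    (auto intro: brace_star_closed add_commutator_closed)

lemma phi_in_Gamma2:
  assumes "X \<in> carrier (B Quot Ann B)" "Y \<in> carrier (B Quot Ann B)"
  shows "phi_star B X Y \<in> Gamma2 B" "phi_plus B X Y \<in> Gamma2 B"
  using assms
  by (auto simp: Quot_carrier phi_star_coset phi_plus_coset Gamma2_def intro!: generate.incl)

text \<open>
  Cosets are handled below through arbitrary representatives. Because each element determines
  its coset, this lemma also yields that distinct cosets are disjoint.
\<close>

lemma coset_rep:
  assumes "X \<in> carrier (B Quot Ann B)" "a \<in> X"
  shows "a \<in> carrier B" "X = Ann B +> a"
proof -
  obtain c z where c: "c \<in> carrier B" "X = Ann B +> c" "z \<in> Ann B" "a = z \<oplus> c"
    using assms by (auto simp: Quot_carrier coset_eq)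
  then show "a \<in> carrier B" "X = Ann B +> a"
    using AnnD(1) coset_absorb by auto
qed

definition commuting_cosets :: "('a set \<times> 'a set) set" where
  "commuting_cosets = {(X, Y) \<in> carrier (B Quot Ann B) \<times> carrier (B Quot Ann B).
     phi_star B X Y = \<one> \<and> phi_star B Y X = \<one> \<and> phi_plus B X Y = \<one>}"

text \<open>
  A pair of elements commutes precisely when its pair of cosets does, so each commuting pair of
  cosets contributes \<open>|Ann B|\<^sup>2\<close> commuting pairs of elements. This factor cancels against the one
  in \<open>|B|\<^sup>2 = |B / Ann B|\<^sup>2 |Ann B|\<^sup>2\<close>.
\<close>

lemma Pb_eq_commuting_cosets:
  assumes fin: "finite (carrier B)"
  shows "Pb B = real (card commuting_cosets) / (real (card (carrier (B Quot Ann B))))\<^sup>2"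
proof -
  let ?Q = "carrier (B Quot Ann B)" and ?k = "card (Ann B)"
  let ?S = "{(a, b) \<in> carrier B \<times> carrier B.
        brace_star B a b = \<one> \<and> brace_star B b a = \<one> \<and> add_commutator B a b = \<one>}"
  have Q: "?Q = rcosets\<^bsub>add_monoid B\<^esub> Ann B"
    by (simp add: FactRing_def A_RCOSETS_def)
  have finQ: "finite ?Q"
    using fin by (simp add: Quot_carrier Setcompr_eq_image)
  have sub: "X \<subseteq> carrier B" if "X \<in> ?Q" for X
    using coset_rep(1)[OF that] by blast
  have card_coset: "card X = ?k" if "X \<in> ?Q" for X
    using plus.card_rcosets_equal[of X "Ann B"] that subgroup.subset[OF Ann_subgroup]
    by (simp add: Q)
  have S: "?S = (\<Union>(X, Y) \<in> commuting_cosets. X \<times> Y)"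
  proof (intro subset_antisym subsetI)
    fix p assume "p \<in> ?S"
    then obtain a b where p: "p = (a, b)" "a \<in> carrier B" "b \<in> carrier B"
      "brace_star B a b = \<one>" "brace_star B b a = \<one>" "add_commutator B a b = \<one>"
      by auto
    then have "(Ann B +> a, Ann B +> b) \<in> commuting_cosets"
      by (simp add: commuting_cosets_def phi_star_coset phi_plus_coset)
    moreover have "c \<in> Ann B +> c" if "c \<in> carrier B" for c
      using plus.rcos_self[OF that Ann_subgroup] by (simp add: a_r_coset_def)
    ultimately show "p \<in> (\<Union>(X, Y) \<in> commuting_cosets. X \<times> Y)"
      using p by blast
  next
    fix p assume "p \<in> (\<Union>(X, Y) \<in> commuting_cosets. X \<times> Y)"
    then obtain X Y a b where XY: "(X, Y) \<in> commuting_cosets" and p: "p = (a, b)" "a \<in> X" "b \<in> Y"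
      by auto
    have "X \<in> ?Q" "Y \<in> ?Q"
      using XY by (auto simp: commuting_cosets_def)
    note X = coset_rep[OF this(1) p(2)] and Y = coset_rep[OF this(2) p(3)]
    show "p \<in> ?S"
      using XY X(1) Y(1) unfolding p(1) X(2) Y(2)
      by (simp add: commuting_cosets_def phi_star_coset phi_plus_coset)
  qed
  have "card ?S = (\<Sum>p \<in> commuting_cosets. card (case p of (X, Y) \<Rightarrow> X \<times> Y))"
    unfolding S
  proof (rule card_UN_disjoint)
    show "finite commuting_cosets"
      by (rule finite_subset[of _ "?Q \<times> ?Q"]) (auto simp: commuting_cosets_def finQ)
    show "\<forall>p \<in> commuting_cosets. finite (case p of (X, Y) \<Rightarrow> X \<times> Y)"
      using sub fin by (auto simp: commuting_cosets_def intro: finite_subset)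
    show "\<forall>p \<in> commuting_cosets. \<forall>q \<in> commuting_cosets. p \<noteq> q \<longrightarrow>
        (case p of (X, Y) \<Rightarrow> X \<times> Y) \<inter> (case q of (X, Y) \<Rightarrow> X \<times> Y) = {}"
    proof (intro ballI impI)
      fix p q assume "p \<in> commuting_cosets" "q \<in> commuting_cosets" and "p \<noteq> q"
      moreover obtain X Y X' Y' where "p = (X, Y)" "q = (X', Y')"
        by (cases p, cases q)
      moreover have "Z = Z'" if "Z \<in> ?Q" "Z' \<in> ?Q" "a \<in> Z" "a \<in> Z'" for Z Z' a
        using coset_rep(2)[OF that(1,3)] coset_rep(2)[OF that(2,4)] by simp
      ultimately show "(case p of (X, Y) \<Rightarrow> X \<times> Y) \<inter> (case q of (X, Y) \<Rightarrow> X \<times> Y) = {}"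
        by (auto simp: commuting_cosets_def)
    qed
  qed
  also have "\<dots> = (\<Sum>p \<in> commuting_cosets. ?k * ?k)"
    by (rule sum.cong) (auto simp: commuting_cosets_def card_cartesian_product card_coset)
  finally have S_card: "card ?S = card commuting_cosets * (?k * ?k)"
    by simp
  have lag: "card ?Q * ?k = card (carrier B)"
    using plus.lagrange[OF Ann_subgroup] by (simp add: Q order_def)
  moreover have "card (carrier B) \<noteq> 0"
    using fin plus.one_closed by auto
  ultimately have "?k \<noteq> 0"
    by (metis mult_0_right)
  then show ?thesis
    unfolding Pb_def S_card lag[symmetric] by (simp add: power2_eq_square)
qed

end

section \<open>Isoclinic braces\<close>

text \<open>
  Both expressions are words in \<open>\<oplus>\<close>, \<open>\<otimes>\<close> and additive
  inverses, and \<open>f\<close> preserves additive inverses because both additive structures are groups.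
\<close>

lemma brace_iso_star_commutator:
  assumes "group (add_monoid A)" "group (add_monoid B)"
    and f: "f \<in> brace_iso A B"
    and a: "a \<in> carrier A" and b: "b \<in> carrier A" and ab: "a \<otimes>\<^bsub>A\<^esub> b \<in> carrier A"
  shows "f (brace_star A a b) = brace_star B (f a) (f b)"
    and "f (add_commutator A a b) = add_commutator B (f a) (f b)"
proof -
  interpret F: group_hom "add_monoid A" "add_monoid B" f
    using assms by (auto simp: group_hom_def group_hom_axioms_def brace_iso_def iso_def)
  have add: "f (x \<oplus>\<^bsub>A\<^esub> y) = f x \<oplus>\<^bsub>B\<^esub> f y" "x \<oplus>\<^bsub>A\<^esub> y \<in> carrier A"
    and inv: "f (\<ominus>\<^bsub>A\<^esub> x) = \<ominus>\<^bsub>B\<^esub> f x" "\<ominus>\<^bsub>A\<^esub> x \<in> carrier A"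
    if "x \<in> carrier A" "y \<in> carrier A" for x y
    using that F.hom_mult[of x y] F.hom_inv[of x] F.G.m_closed[of x y] F.G.inv_closed[of x]
    by (simp_all add: a_inv_def)
  have circ: "f (a \<otimes>\<^bsub>A\<^esub> b) = f a \<otimes>\<^bsub>B\<^esub> f b"
    using f a b by (auto simp: brace_iso_def iso_def hom_def)
  show "f (brace_star A a b) = brace_star B (f a) (f b)"
    and "f (add_commutator A a b) = add_commutator B (f a) (f b)"
    using a b ab by (simp_all add: brace_star_def add_commutator_def a_minus_def add inv circ)
qed

locale isoclinism = A: skew_left_brace A + B: skew_left_brace B
  for A :: "('a, 'm) ring_scheme" and B :: "('b, 'n) ring_scheme" +
  fixes \<xi> :: "'a set \<Rightarrow> 'b set" and \<theta> :: "'a \<Rightarrow> 'b"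
  assumes xi: "\<xi> \<in> brace_iso (A Quot Ann A) (B Quot Ann B)"
    and theta: "\<theta> \<in> brace_iso (A\<lparr>carrier := Gamma2 A\<rparr>) (B\<lparr>carrier := Gamma2 B\<rparr>)"
    and theta_phi_plus: "\<lbrakk>X \<in> carrier (A Quot Ann A); Y \<in> carrier (A Quot Ann A)\<rbrakk>
      \<Longrightarrow> \<theta> (phi_plus A X Y) = phi_plus B (\<xi> X) (\<xi> Y)"
    and theta_phi_star: "\<lbrakk>X \<in> carrier (A Quot Ann A); Y \<in> carrier (A Quot Ann A)\<rbrakk>
      \<Longrightarrow> \<theta> (phi_star A X Y) = phi_star B (\<xi> X) (\<xi> Y)"
begin

lemma xi_bij: "bij_betw \<xi> (carrier (A Quot Ann A)) (carrier (B Quot Ann B))"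
  using xi by (simp add: brace_iso_def iso_def)

lemma theta_bij: "bij_betw \<theta> (Gamma2 A) (Gamma2 B)"
  using theta by (simp add: brace_iso_def iso_def)

lemma theta_hom: "\<theta> \<in> hom ((add_monoid A)\<lparr>carrier := Gamma2 A\<rparr>) ((add_monoid B)\<lparr>carrier := Gamma2 B\<rparr>)"
  using theta by (auto simp: brace_iso_def iso_def hom_def)

lemma theta_one: "\<theta> \<one>\<^bsub>A\<^esub> = \<one>\<^bsub>B\<^esub>"
proof -
  have "group ((add_monoid A)\<lparr>carrier := Gamma2 A\<rparr>)" "group ((add_monoid B)\<lparr>carrier := Gamma2 B\<rparr>)"
    by (fact group.subgroup_imp_group[OF A.add_group A.Gamma2_subgroup]
        group.subgroup_imp_group[OF B.add_group B.Gamma2_subgroup])+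
  from hom_one[OF theta_hom this] show ?thesis
    by (simp add: A.one_eq_zero B.one_eq_zero)
qed

lemma theta_eq_one_iff:
  assumes "g \<in> Gamma2 A"
  shows "\<theta> g = \<one>\<^bsub>B\<^esub> \<longleftrightarrow> g = \<one>\<^bsub>A\<^esub>"
proof -
  have "\<one>\<^bsub>A\<^esub> \<in> Gamma2 A"
    using subgroup.one_closed[OF A.Gamma2_subgroup] by (simp add: A.one_eq_zero)
  then show ?thesis
    using theta_one theta_bij assms by (metis bij_betw_def inj_onD)
qed

lemma card_commuting_cosets: "card A.commuting_cosets = card B.commuting_cosets"
proof (rule bij_betw_same_card)
  let ?Q = "carrier (A Quot Ann A)" and ?R = "carrier (B Quot Ann B)"
  have bij: "bij_betw (map_prod \<xi> \<xi>) (?Q \<times> ?Q) (?R \<times> ?R)"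
    by (rule bij_betw_map_prod[OF xi_bij xi_bij])
  have iff: "map_prod \<xi> \<xi> p \<in> B.commuting_cosets \<longleftrightarrow> p \<in> A.commuting_cosets"
    if p: "p \<in> ?Q \<times> ?Q" for p
  proof -
    have *: "phi_star B (\<xi> X) (\<xi> Y) = \<one>\<^bsub>B\<^esub> \<longleftrightarrow> phi_star A X Y = \<one>\<^bsub>A\<^esub>"
      "phi_plus B (\<xi> X) (\<xi> Y) = \<one>\<^bsub>B\<^esub> \<longleftrightarrow> phi_plus A X Y = \<one>\<^bsub>A\<^esub>"
      if "X \<in> ?Q" "Y \<in> ?Q" for X Y
      using theta_eq_one_iff[OF A.phi_in_Gamma2(1)[OF that]]
        theta_eq_one_iff[OF A.phi_in_Gamma2(2)[OF that]]
      unfolding theta_phi_star[OF that] theta_phi_plus[OF that] by simp_all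
    obtain X Y where XY: "p = (X, Y)" "X \<in> ?Q" "Y \<in> ?Q"
      using p by (rule SigmaE)
    then have "\<xi> X \<in> ?R" "\<xi> Y \<in> ?R"
      using bij_betwE[OF xi_bij] by blast+
    then show ?thesis
      by (simp add: A.commuting_cosets_def B.commuting_cosets_def XY *)
  qed
  have "{p \<in> ?Q \<times> ?Q. p \<in> A.commuting_cosets} = A.commuting_cosets"
    "{p \<in> ?R \<times> ?R. p \<in> B.commuting_cosets} = B.commuting_cosets"
    unfolding A.commuting_cosets_def B.commuting_cosets_def by blast+
  moreover have "bij_betw (map_prod \<xi> \<xi>) {p \<in> ?Q \<times> ?Q. p \<in> A.commuting_cosets}
      {p \<in> ?R \<times> ?R. p \<in> B.commuting_cosets}"
    by (rule bij_betw_Collect[OF bij]) (rule iff)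
  ultimately show "bij_betw (map_prod \<xi> \<xi>) A.commuting_cosets B.commuting_cosets"
    by (simp only:)
qed

text \<open>
  The two components of an isoclinism are linked on \<open>\<Gamma>\<^sub>2\<close>: the intertwining relations,
  read modulo the annihilators, give this identity on the generators.
\<close>

lemma xi_coset_Gamma2:
  assumes "g \<in> Gamma2 A"
  shows "\<xi> (Ann A +>\<^bsub>A\<^esub> g) = Ann B +>\<^bsub>B\<^esub> \<theta> g"
proof -
  let ?S = "{brace_star A a b | a b. a \<in> carrier A \<and> b \<in> carrier A} \<union>
      {add_commutator A a b | a b. a \<in> carrier A \<and> b \<in> carrier A}"
  let ?G = "(add_monoid A)\<lparr>carrier := Gamma2 A\<rparr>" and ?K = "add_monoid (B Quot Ann B)"
  have subA: "Gamma2 A \<subseteq> carrier A" and subB: "Gamma2 B \<subseteq> carrier B"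
    using subgroup.subset[OF A.Gamma2_subgroup] subgroup.subset[OF B.Gamma2_subgroup] by auto
  have xi_hom: "\<xi> \<in> hom (add_monoid (A Quot Ann A)) ?K"
    using xi by (simp add: brace_iso_def iso_def)
  have f: "(\<lambda>g. \<xi> (Ann A +>\<^bsub>A\<^esub> g)) \<in> hom ?G ?K"
    using xi_hom subA by (auto simp: hom_def Pi_iff subset_eq simp flip: A.Quot_add)
  have h: "(\<lambda>g. Ann B +>\<^bsub>B\<^esub> \<theta> g) \<in> hom ?G ?K"
    using theta_hom subB by (auto simp: hom_def Pi_iff subset_eq B.Quot_add)
  have eq: "\<xi> (Ann A +>\<^bsub>A\<^esub> s) = Ann B +>\<^bsub>B\<^esub> \<theta> s" if s: "s \<in> ?S" for s
  proof -
    obtain a b where a: "a \<in> carrier A" and b: "b \<in> carrier A"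
      and s': "s = brace_star A a b \<or> s = add_commutator A a b"
      using s by blast
    \<comment> \<open>Representatives \<open>x\<close>, \<open>y\<close> of the image cosets turn \<open>\<phi> (\<xi> X) (\<xi> Y)\<close> into an element of \<open>B\<close>
        whose class is the one computed in the quotient brace.\<close>
    let ?X = "Ann A +>\<^bsub>A\<^esub> a" and ?Y = "Ann A +>\<^bsub>A\<^esub> b"
    have "\<xi> ?X \<in> carrier (B Quot Ann B)" "\<xi> ?Y \<in> carrier (B Quot Ann B)"
      using bij_betwE[OF xi_bij] a b by auto
    then obtain x y where x: "x \<in> carrier B" "\<xi> ?X = Ann B +>\<^bsub>B\<^esub> x"
      and y: "y \<in> carrier B" "\<xi> ?Y = Ann B +>\<^bsub>B\<^esub> y"
      by (auto simp: B.Quot_carrier)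
    note pres = brace_iso_star_commutator[OF A.group_add_monoid_Quot_Ann B.group_add_monoid_Quot_Ann xi,
        of ?X ?Y]
    have "\<xi> (Ann A +>\<^bsub>A\<^esub> brace_star A a b) = Ann B +>\<^bsub>B\<^esub> \<theta> (brace_star A a b)"
      using pres(1) theta_phi_star[of ?X ?Y] a b x y
      by (simp add: A.Quot_star B.Quot_star A.Quot_circ_closed A.phi_star_coset B.phi_star_coset)
    moreover have "\<xi> (Ann A +>\<^bsub>A\<^esub> add_commutator A a b) = Ann B +>\<^bsub>B\<^esub> \<theta> (add_commutator A a b)"
      using pres(2) theta_phi_plus[of ?X ?Y] a b x y
      by (simp add: A.Quot_commutator B.Quot_commutator A.Quot_circ_closed A.phi_plus_coset B.phi_plus_coset)
    ultimately show ?thesis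
      using s' by blast
  qed
  have "?S \<subseteq> carrier (add_monoid A)"
    by (auto intro: A.brace_star_closed A.add_commutator_closed)
  then show ?thesis
    using hom_eq_on_generate[OF A.add_group B.group_add_monoid_Quot_Ann _ f[unfolded Gamma2_def]
        h[unfolded Gamma2_def] eq assms[unfolded Gamma2_def]]
    by simp
qed

text \<open>
  Membership in the annihilator means having trivial class, and the injective homomorphism
  \<open>\<xi>\<close> preserves and reflects triviality of classes.
\<close>

lemma theta_in_Ann_iff:
  assumes g: "g \<in> Gamma2 A"
  shows "\<theta> g \<in> Ann B \<longleftrightarrow> g \<in> Ann A"
proof -
  have gA: "g \<in> carrier A" and tB: "\<theta> g \<in> carrier B"
    using g bij_betwE[OF theta_bij] subgroup.subset[OF A.Gamma2_subgroup]
      subgroup.subset[OF B.Gamma2_subgroup] by auto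
  have xi_hom: "\<xi> \<in> hom (add_monoid (A Quot Ann A)) (add_monoid (B Quot Ann B))"
    using xi by (simp add: brace_iso_def iso_def)
  have xi_zero: "\<xi> \<zero>\<^bsub>A Quot Ann A\<^esub> = \<zero>\<^bsub>B Quot Ann B\<^esub>"
    using hom_one[OF xi_hom A.group_add_monoid_Quot_Ann B.group_add_monoid_Quot_Ann] by simp
  have "\<zero>\<^bsub>A Quot Ann A\<^esub> \<in> carrier (A Quot Ann A)"
    using group.is_monoid[OF A.group_add_monoid_Quot_Ann] monoid.one_closed by fastforce
  then have "\<xi> (Ann A +>\<^bsub>A\<^esub> g) = \<zero>\<^bsub>B Quot Ann B\<^esub> \<longleftrightarrow> Ann A +>\<^bsub>A\<^esub> g = \<zero>\<^bsub>A Quot Ann A\<^esub>"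
    using xi_zero xi_bij A.coset_in_Quot[OF gA] by (metis bij_betw_def inj_onD)
  then show ?thesis
    using A.coset_eq_zero_iff[OF gA] B.coset_eq_zero_iff[OF tB] xi_coset_Gamma2[OF g] by simp
qed

lemma card_Gamma2_Ann: "card (Gamma2 A \<inter> Ann A) = card (Gamma2 B \<inter> Ann B)"
proof (rule bij_betw_same_card)
  have "\<theta> ` Gamma2 A = Gamma2 B"
    using theta_bij by (rule bij_betw_imp_surj_on)
  then have "\<theta> ` (Gamma2 A \<inter> Ann A) = Gamma2 B \<inter> Ann B"
    by (force simp: theta_in_Ann_iff)
  then show "bij_betw \<theta> (Gamma2 A \<inter> Ann A) (Gamma2 B \<inter> Ann B)"
    by (intro bij_betw_subset[OF theta_bij]) auto
qed

end

theorem theorem4p7: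
  fixes A :: "('a, 'm) ring_scheme" and B :: "('b, 'n) ring_scheme"
  assumes "skew_left_brace A" and "skew_left_brace B"
    and "finite (carrier A)" and "finite (carrier B)"
    and "isoclinic A B"
  shows "Pb A = Pb B \<and> card (Gamma2 A \<inter> Ann A) = card (Gamma2 B \<inter> Ann B)"
proof -
  obtain \<xi> \<theta> where "isoclinism A B \<xi> \<theta>"
    using assms(1,2,5) by (auto simp: isoclinic_def isoclinism_def isoclinism_axioms_def)
  then interpret isoclinism A B \<xi> \<theta> .
  have "Pb A = Pb B"
    unfolding A.Pb_eq_commuting_cosets[OF assms(3)] B.Pb_eq_commuting_cosets[OF assms(4)]
    using card_commuting_cosets bij_betw_same_card[OF xi_bij] by simp
  then show ?thesis
    using card_Gamma2_Ann by simp
qed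

end
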